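(* Let $G$ be a finite group and let $\gamma=\{\gamma_j:\{1,2,\dots,k\}\to\mathbb{C}\}_{j=0,1,\dots,J}$ be a kernel satisfying $$\sum_{j=1}^J|\gamma_j(r)|^2=1-|\gamma_0(r)|^2,\qquad r=1,2,\dots,k.$$ Then the associated $G$-scattering transform is stable in the following sense: for all $f,f'\in L^2(G)$, $$\|S[P_J]f-S[P_J]f'\|_{2,J}\le\|f-f'\|.$$
   Context: $G$ is a finite group (not necessarily abelian). $L^2(G)$ is the space of all functions $f:G\to\mathbb{C}$ with inner product $\langle f,g\rangle=\frac{1}{|G|}\sum_{x\in G}f(x)\overline{g(x)}$ and induced norm $\|f\|$. Convolution is $f*g(x)=\frac{1}{|G|}\sum_{y\in G}f(y)g(y^{-1}x)$. $\pi^1,\dots,\pi^k$ is a complete system of pairwise inequivalent irreducible unitary representations of $G$, $d_r$ is the degree of $\pi^r$ and $\chi^r(x)=\mathrm{Tr}(\pi^r(x))$. Fix an integer $J\ge1$. A kernel is a family of functions $\gamma=\{\gamma_j:\{1,\dots,k\}\to\mathbb{C}\}_{0\le j\le J}$; its $G$-wavelets are $\psi_j(x)=\sum_{r=1}^k d_r\gamma_j(r)\chi^r(x)$, $0\le j\le J$, and we write $\phi=\psi_0$. For $m\ge1$, $\Lambda_J^m=\{1,\dots,J\}^m$ is the set of paths of length $m$; $\Lambda_J^0$ consists only of the empty path $\emptyset$; $P_J=\bigcup_{m\ge0}\Lambda_J^m$. For $f\in L^2(G)$, $U[\emptyset]f=f$, $U[j]f=|\psi_j*f|$ (pointwise modulus)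 for $1\le j\le J$, and $U[p]f=U[j_m]\cdots U[j_1]f$ for $p=(j_1,\dots,j_m)\in\Lambda_J^m$. For $p\in P_J$, $S[p]f=\phi*U[p]f$. The $G$-scattering transform is $S[P_J]f=\{S[p]f\}_{p\in P_J}$, and for a family $F=\{F_p\}_{p\in P_J}$ in $L^2(G)$, $\|F\|_{2,J}=\left(\sum_{p\in P_J}\|F_p\|^2\right)^{1/2}$; differences of families are taken entrywise. *)

theory Defs
  imports
    "HOL-Algebra.Coset"
    "HOL-Analysis.Infinite_Sum"
    "Jordan_Normal_Form.Schur_Decomposition"
    "Jordan_Normal_Form.VS_Connect"
begin

section \<open>Functions on a finite group\<close>

text \<open>
  An element of \<open>L\<^sup>2(G)\<close> is given by a function of type \<open>'a \<Rightarrow> complex\<close>; its values outside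
  \<open>carrier G\<close> are irrelevant, as all sums below range over \<open>carrier G\<close>.
\<close>

definition L2_inner :: "('a, 'b) monoid_scheme \<Rightarrow> ('a \<Rightarrow> complex) \<Rightarrow> ('a \<Rightarrow> complex) \<Rightarrow> complex" where
  "L2_inner G f g = (1 / of_nat (Coset.order G)) * (\<Sum>x\<in>carrier G. f x * cnj (g x))"

definition L2_norm :: "('a, 'b) monoid_scheme \<Rightarrow> ('a \<Rightarrow> complex) \<Rightarrow> real" where
  "L2_norm G f = sqrt (Re (L2_inner G f f))"

definition convol ::
  "('a, 'b) monoid_scheme \<Rightarrow> ('a \<Rightarrow> complex) \<Rightarrow> ('a \<Rightarrow> complex) \<Rightarrow> 'a \<Rightarrow> complex" where
  "convol G f g x = (1 / of_nat (Coset.order G)) * (\<Sum>y\<in>carrier G. f y * g (inv\<^bsub>G\<^esub> y \<otimes>\<^bsub>G\<^esub> x))"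


section \<open>Irreducible unitary representations\<close>

definition mtrace :: "complex mat \<Rightarrow> complex" where
  "mtrace A = (\<Sum>i<dim_row A. A $$ (i, i))"

definition unitary_mat :: "nat \<Rightarrow> complex mat \<Rightarrow> bool" where
  "unitary_mat n A \<longleftrightarrow> A \<in> carrier_mat n n \<and>
     mat_adjoint A * A = 1\<^sub>m n \<and> A * mat_adjoint A = 1\<^sub>m n"

definition unitary_rep :: "('a, 'b) monoid_scheme \<Rightarrow> nat \<Rightarrow> ('a \<Rightarrow> complex mat) \<Rightarrow> bool" where
  "unitary_rep G n \<rho> \<longleftrightarrow>
     (\<forall>x\<in>carrier G. unitary_mat n (\<rho> x)) \<and>
     (\<forall>x\<in>carrier G. \<forall>y\<in>carrier G. \<rho> (x \<otimes>\<^bsub>G\<^esub> y) = \<rho> x * \<rho> y)"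

definition irreducible_rep :: "('a, 'b) monoid_scheme \<Rightarrow> nat \<Rightarrow> ('a \<Rightarrow> complex mat) \<Rightarrow> bool" where
  "irreducible_rep G n \<rho> \<longleftrightarrow> n > 0 \<and>
     (\<forall>W. VectorSpace.subspace class_ring W (module_vec TYPE(complex) n) \<longrightarrow>
          (\<forall>x\<in>carrier G. \<forall>w\<in>W. \<rho> x *\<^sub>v w \<in> W) \<longrightarrow>
          W = {0\<^sub>v n} \<or> W = carrier_vec n)"

definition equivalent_reps ::
  "('a, 'b) monoid_scheme \<Rightarrow> nat \<Rightarrow> ('a \<Rightarrow> complex mat) \<Rightarrow> nat \<Rightarrow> ('a \<Rightarrow> complex mat) \<Rightarrow> bool" where
  "equivalent_reps G m \<rho> n \<sigma> \<longleftrightarrow>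
     (\<exists>T\<in>carrier_mat n m. invertible_mat T \<and> (\<forall>x\<in>carrier G. T * \<rho> x = \<sigma> x * T))"

definition complete_irrep_system ::
  "('a, 'b) monoid_scheme \<Rightarrow> nat \<Rightarrow> (nat \<Rightarrow> nat) \<Rightarrow> (nat \<Rightarrow> 'a \<Rightarrow> complex mat) \<Rightarrow> bool" where
  "complete_irrep_system G k d \<pi> \<longleftrightarrow>
     (\<forall>r\<in>{1..k}. unitary_rep G (d r) (\<pi> r) \<and> irreducible_rep G (d r) (\<pi> r)) \<and>
     (\<forall>r\<in>{1..k}. \<forall>s\<in>{1..k}. r \<noteq> s \<longrightarrow> \<not> equivalent_reps G (d r) (\<pi> r) (d s) (\<pi> s)) \<and>
     (\<forall>n \<rho>. unitary_rep G n \<rho> \<and> irreducible_rep G n \<rho> \<longrightarrow>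
        (\<exists>r\<in>{1..k}. equivalent_reps G n \<rho> (d r) (\<pi> r)))"


section \<open>The scattering transform\<close>

text \<open>
  A kernel is given by \<open>\<gamma> j r\<close> with \<open>j \<in> {0..J}\<close> and \<open>r \<in> {1..k}\<close>; its other values play no role.
\<close>

definition wavelet ::
  "nat \<Rightarrow> (nat \<Rightarrow> nat) \<Rightarrow> (nat \<Rightarrow> 'a \<Rightarrow> complex mat) \<Rightarrow> (nat \<Rightarrow> nat \<Rightarrow> complex) \<Rightarrow> nat \<Rightarrow> 'a \<Rightarrow> complex"
where
  "wavelet k d \<pi> \<gamma> j x = (\<Sum>r=1..k. of_nat (d r) * \<gamma> j r * mtrace (\<pi> r x))"

definition paths :: "nat \<Rightarrow> nat list set" where
  "paths J = {p. set p \<subseteq> {1..J}}"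

text \<open>
  For the path \<open>(j\<^sub>1, \<dots>, j\<^sub>m)\<close>, represented by a list, the propagator
  of \<open>j\<^sub>1\<close>, the head of the list, is applied first.
\<close>

primrec scatter_prop ::
  "('a, 'b) monoid_scheme \<Rightarrow> (nat \<Rightarrow> 'a \<Rightarrow> complex) \<Rightarrow> nat list \<Rightarrow> ('a \<Rightarrow> complex) \<Rightarrow> 'a \<Rightarrow> complex"
where
  "scatter_prop G \<psi> [] f = f"
| "scatter_prop G \<psi> (j # p) f =
     scatter_prop G \<psi> p (\<lambda>x. complex_of_real (cmod (convol G (\<psi> j) f x)))"

definition scattering ::
  "('a, 'b) monoid_scheme \<Rightarrow> nat \<Rightarrow> (nat \<Rightarrow> nat) \<Rightarrow> (nat \<Rightarrow> 'a \<Rightarrow> complex mat) \<Rightarrow>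
   (nat \<Rightarrow> nat \<Rightarrow> complex) \<Rightarrow> ('a \<Rightarrow> complex) \<Rightarrow> nat list \<Rightarrow> 'a \<Rightarrow> complex"
where
  "scattering G k d \<pi> \<gamma> f p =
     convol G (wavelet k d \<pi> \<gamma> 0) (scatter_prop G (wavelet k d \<pi> \<gamma>) p f)"

text \<open>
  The sum over the paths is a real \<open>infsum\<close>, so a path norm is only meaningful
  for families satisfying \<open>path_finite\<close>.
\<close>

definition path_finite :: "('a, 'b) monoid_scheme \<Rightarrow> nat \<Rightarrow> (nat list \<Rightarrow> 'a \<Rightarrow> complex) \<Rightarrow> bool" where
  "path_finite G J F \<longleftrightarrow> (\<lambda>p. (L2_norm G (F p))\<^sup>2) summable_on paths J"

definition path_norm :: "('a, 'b) monoid_scheme \<Rightarrow> nat \<Rightarrow> (nat list \<Rightarrow> 'a \<Rightarrow> complex) \<Rightarrow> real" where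
  "path_norm G J F = sqrt (\<Sum>\<^sub>\<infinity>p\<in>paths J. (L2_norm G (F p))\<^sup>2)"

end

theory Submission
  imports Defs "Jordan_Normal_Form.Spectral_Radius"
begin

text \<open>
  The transform is stable because the wavelets satisfy the Littlewood-Paley inequality
  \<open>\<Sum>\<^sub>j \<parallel>\<psi>\<^sub>j * g\<parallel>\<^sup>2 \<le> \<parallel>g\<parallel>\<^sup>2\<close>, the sum being over \<open>0 \<le> j \<le> J\<close> (lemma \<open>wavelet_bessel\<close>), and
  because the modulus is a contraction. Given the inequality for \<open>g = f - f'\<close>, the summand
  \<open>j = 0\<close> is the contribution of the empty path, and the summand \<open>j \<ge> 1\<close> dominates
  \<open>\<parallel>|\<psi>\<^sub>j * f| - |\<psi>\<^sub>j * f'|\<parallel>\<^sup>2\<close>, which by induction on the length bounds the contribution of all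
  paths of bounded length that begin with \<open>j\<close> (lemma \<open>scatter_prop_contraction\<close>). So every
  finite partial sum over the paths is at most \<open>\<parallel>f - f'\<parallel>\<^sup>2\<close>, which gives both summability and
  the bound.

  For the Littlewood-Paley inequality put \<open>e\<^sub>r = d\<^sub>r \<chi>\<^sup>r\<close>. The character relations give
  \<open>e\<^sub>r * e\<^sub>s = e\<^sub>r\<close> if \<open>r = s\<close> and \<open>0\<close> otherwise (lemma \<open>irrep_kernel_convol\<close>), and unitarity
  makes convolution with \<open>e\<^sub>r\<close> self-adjoint, so these convolutions are orthogonal projections
  with mutually orthogonal ranges. As \<open>\<psi>\<^sub>j = \<Sum>\<^sub>r \<gamma>\<^sub>j(r) e\<^sub>r\<close>, the left-hand side equals
  \<open>\<Sum>\<^sub>r (\<Sum>\<^sub>j |\<gamma>\<^sub>j(r)|\<^sup>2) \<parallel>e\<^sub>r * g\<parallel>\<^sup>2\<close>, whose inner sums are all \<open>1\<close>, and Bessel's inequality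
  applies.

  The character relations rest on Schur's lemma in two forms: a matrix commuting with an
  irreducible representation is scalar (lemma \<open>commuting_scalar\<close>), and a nonzero intertwiner of
  two irreducible unitary representations makes them equivalent
  (lemma \<open>intertwiner_zero_or_equivalent\<close>).
\<close>

section \<open>Adjoints and traces of complex matrices\<close>

lemma mat_adjoint_carrier [simp, intro]:
  "A \<in> carrier_mat n m \<Longrightarrow> mat_adjoint A \<in> carrier_mat m n"
  unfolding mat_adjoint_def by auto

lemma mat_adjoint_index:
  fixes A :: "complex mat"
  assumes "A \<in> carrier_mat n m" "i < m" "j < n"
  shows "mat_adjoint A $$ (i, j) = cnj (A $$ (j, i))"
  using assms unfolding mat_adjoint_def by (simp add: mat_of_rows_index)

lemma mult_mat_index:
  assumes "A \<in> carrier_mat n m" "B \<in> carrier_mat m l" "i < n" "j < l"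
  shows "(A * B) $$ (i, j) = (\<Sum>c<m. A $$ (i, c) * B $$ (c, j))"
  using assms by (simp add: scalar_prod_def atLeast0LessThan)

lemma mat_adjoint_mult:
  fixes A B :: "complex mat"
  assumes A: "A \<in> carrier_mat n m" and B: "B \<in> carrier_mat m l"
  shows "mat_adjoint (A * B) = mat_adjoint B * mat_adjoint A"
proof (rule eq_matI)
  fix i j assume "i < dim_row (mat_adjoint B * mat_adjoint A)"
    "j < dim_col (mat_adjoint B * mat_adjoint A)"
  with A B have i: "i < l" and j: "j < n"
    using mat_adjoint_carrier[OF A] mat_adjoint_carrier[OF B] by auto
  have "mat_adjoint (A * B) $$ (i, j) = cnj ((A * B) $$ (j, i))"
    using A B i j by (intro mat_adjoint_index) auto
  also have "\<dots> = (\<Sum>c<m. mat_adjoint B $$ (i, c) * mat_adjoint A $$ (c, j))"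
    using i j by (auto simp: mult_mat_index[OF A B j i] mat_adjoint_index[OF A]
        mat_adjoint_index[OF B] intro!: sum.cong)
  also have "\<dots> = (mat_adjoint B * mat_adjoint A) $$ (i, j)"
    using mult_mat_index[OF mat_adjoint_carrier[OF B] mat_adjoint_carrier[OF A] i j] by simp
  finally show "mat_adjoint (A * B) $$ (i, j) = (mat_adjoint B * mat_adjoint A) $$ (i, j)" .
qed (use mat_adjoint_carrier[OF A] mat_adjoint_carrier[OF B]
    mat_adjoint_carrier[OF mult_carrier_mat[OF A B]] in auto)

lemma mtrace_mult_comm:
  assumes A: "A \<in> carrier_mat n m" and B: "B \<in> carrier_mat m n"
  shows "mtrace (A * B) = mtrace (B * A)"
proof -
  have "mtrace (A * B) = (\<Sum>i<n. \<Sum>c<m. A $$ (i, c) * B $$ (c, i))"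
    using A unfolding mtrace_def by (simp add: mult_mat_index[OF A B])
  also have "\<dots> = (\<Sum>c<m. \<Sum>i<n. B $$ (c, i) * A $$ (i, c))"
    by (subst sum.swap) (simp add: mult.commute)
  also have "\<dots> = mtrace (B * A)"
    using B unfolding mtrace_def by (simp add: mult_mat_index[OF B A])
  finally show ?thesis .
qed

lemma mtrace_smult_one: "mtrace (c \<cdot>\<^sub>m 1\<^sub>m n) = of_nat n * c"
  unfolding mtrace_def by simp

lemma mtrace_adjoint_mult:
  assumes A: "A \<in> carrier_mat n m"
  shows "mtrace (mat_adjoint A * A) = complex_of_real (\<Sum>i<m. \<Sum>c<n. (cmod (A $$ (c, i)))\<^sup>2)"
  unfolding mtrace_def
  using mat_adjoint_carrier[OF A]
  by (simp add: mult_mat_index[OF mat_adjoint_carrier[OF A] A] mat_adjoint_index[OF A]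
      complex_norm_square mult.commute del: of_real_power)

lemma adjoint_mult_eq_zeroD:
  assumes A: "A \<in> carrier_mat n m" and "mtrace (mat_adjoint A * A) = 0"
  shows "A = 0\<^sub>m n m"
proof -
  have "(\<Sum>i<m. \<Sum>c<n. (cmod (A $$ (c, i)))\<^sup>2) = 0"
    using assms(2) mtrace_adjoint_mult[OF A] of_real_eq_0_iff by metis
  hence "\<forall>i<m. \<forall>c<n. A $$ (c, i) = 0"
    by (subst (asm) sum_nonneg_eq_0_iff) (auto simp: sum_nonneg_eq_0_iff sum_nonneg)
  with A show ?thesis by (intro eq_matI) auto
qed

section \<open>Schur's lemma for unitary representations\<close>

lemma unitary_repD:
  assumes "unitary_rep G n \<rho>" "x \<in> carrier G"
  shows "\<rho> x \<in> carrier_mat n n" "mat_adjoint (\<rho> x) * \<rho> x = 1\<^sub>m n"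
    "\<rho> x * mat_adjoint (\<rho> x) = 1\<^sub>m n"
    "y \<in> carrier G \<Longrightarrow> \<rho> (x \<otimes>\<^bsub>G\<^esub> y) = \<rho> x * \<rho> y"
  using assms unfolding unitary_rep_def unitary_mat_def by auto

lemma (in group) unitary_rep_one:
  assumes \<rho>: "unitary_rep G n \<rho>"
  shows "\<rho> \<one> = 1\<^sub>m n"
proof -
  note D = unitary_repD[OF \<rho> one_closed]
  have "\<rho> \<one> = (mat_adjoint (\<rho> \<one>) * \<rho> \<one>) * \<rho> \<one>"
    using D by simp
  also have "\<dots> = mat_adjoint (\<rho> \<one>) * (\<rho> \<one> * \<rho> \<one>)"
    using D(1) by (intro assoc_mult_mat) auto
  also have "\<rho> \<one> * \<rho> \<one> = \<rho> \<one>"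
    using D(4)[OF one_closed] by simp
  finally show ?thesis using D(2) by simp
qed

lemma (in group) unitary_rep_inv:
  assumes \<rho>: "unitary_rep G n \<rho>" and x: "x \<in> carrier G"
  shows "\<rho> (inv x) = mat_adjoint (\<rho> x)"
proof -
  note D = unitary_repD[OF \<rho> x] and Di = unitary_repD[OF \<rho> inv_closed[OF x]]
  have "\<rho> (inv x) = (mat_adjoint (\<rho> x) * \<rho> x) * \<rho> (inv x)"
    using D Di by simp
  also have "\<dots> = mat_adjoint (\<rho> x) * (\<rho> x * \<rho> (inv x))"
    using D(1) Di(1) by (intro assoc_mult_mat) auto
  also have "\<rho> x * \<rho> (inv x) = 1\<^sub>m n"
    using D(4)[OF inv_closed[OF x]] x unitary_rep_one[OF \<rho>] by simp
  finally show ?thesis using mat_adjoint_carrier[OF D(1)] by simp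
qed

text \<open>
  Schur's lemma over the complex numbers: \<open>M\<close> has an eigenvalue, and its eigenspace is a nonzero
  invariant subspace, hence everything.
\<close>

lemma commuting_scalar:
  assumes \<rho>: "unitary_rep G n \<rho>" and irr: "irreducible_rep G n \<rho>"
    and M: "M \<in> carrier_mat n n"
    and comm: "\<And>x. x \<in> carrier G \<Longrightarrow> M * \<rho> x = \<rho> x * M"
  obtains c where "M = c \<cdot>\<^sub>m 1\<^sub>m n"
proof -
  have "n > 0" using irr unfolding irreducible_rep_def by simp
  then obtain c where "eigenvalue M c"
    using spectrum_non_empty[OF M] unfolding spectrum_def by auto
  then obtain v where v: "v \<in> carrier_vec n" "v \<noteq> 0\<^sub>v n" "M *\<^sub>v v = c \<cdot>\<^sub>v v"
    using M unfolding eigenvalue_def eigenvector_def by auto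
  define W where "W = {w \<in> carrier_vec n. M *\<^sub>v w = c \<cdot>\<^sub>v w}"
  interpret vec_space "TYPE(complex)" n .
  have "VectorSpace.subspace class_ring W (module_vec TYPE(complex) n)"
  proof (unfold_locales)
    show "W \<subseteq> carrier (module_vec TYPE(complex) n)"
      unfolding W_def by (auto simp: module_vec_simps)
  next
    fix u w assume "u \<in> W" "w \<in> W"
    thus "u \<oplus>\<^bsub>module_vec TYPE(complex) n\<^esub> w \<in> W"
      using M unfolding W_def
      by (auto simp: module_vec_simps mult_add_distrib_mat_vec smult_add_distrib_vec)
  next
    show "\<zero>\<^bsub>module_vec TYPE(complex) n\<^esub> \<in> W"
      using M unfolding W_def by (auto simp: module_vec_simps)
  next
    fix a :: complex and w assume "w \<in> W"
    thus "a \<odot>\<^bsub>module_vec TYPE(complex) n\<^esub> w \<in> W"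
      using M unfolding W_def
      by (auto simp: module_vec_simps mult_mat_vec smult_smult_assoc mult.commute)
  qed
  moreover have "\<rho> x *\<^sub>v w \<in> W" if x: "x \<in> carrier G" and "w \<in> W" for x w
  proof -
    have w: "w \<in> carrier_vec n" "M *\<^sub>v w = c \<cdot>\<^sub>v w" using \<open>w \<in> W\<close> unfolding W_def by auto
    note R = unitary_repD(1)[OF \<rho> x]
    have "M *\<^sub>v (\<rho> x *\<^sub>v w) = \<rho> x *\<^sub>v (M *\<^sub>v w)"
      using assoc_mult_mat_vec[OF M R w(1)] assoc_mult_mat_vec[OF R M w(1)] comm[OF x] by simp
    also have "\<dots> = c \<cdot>\<^sub>v (\<rho> x *\<^sub>v w)"
      using w R by (simp add: mult_mat_vec)
    finally show ?thesis unfolding W_def using w R by simp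
  qed
  ultimately have "W = {0\<^sub>v n} \<or> W = carrier_vec n"
    using irr unfolding irreducible_rep_def by blast
  moreover have "v \<in> W" using v unfolding W_def by simp
  ultimately have W: "W = carrier_vec n" using v(2) by auto
  have "M = c \<cdot>\<^sub>m 1\<^sub>m n"
  proof (rule eq_matI)
    fix i j assume "i < dim_row (c \<cdot>\<^sub>m 1\<^sub>m n :: complex mat)" "j < dim_col (c \<cdot>\<^sub>m 1\<^sub>m n :: complex mat)"
    hence ij: "i < n" "j < n" by auto
    have "unit_vec n j \<in> W" using W by simp
    hence "M *\<^sub>v unit_vec n j = c \<cdot>\<^sub>v unit_vec n j" unfolding W_def by simp
    hence "(M *\<^sub>v unit_vec n j) $ i = (c \<cdot>\<^sub>v unit_vec n j) $ i" by simp
    thus "M $$ (i, j) = (c \<cdot>\<^sub>m 1\<^sub>m n) $$ (i, j)"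
      using ij M by (simp add: scalar_prod_right_unit)
  qed (use M in auto)
  thus ?thesis by (rule that)
qed

text \<open>
  Unitarity reduces this form of Schur's lemma to the previous one, with no dimension count:
  the adjoint \<open>T'\<close> of \<open>T\<close> intertwines in the other direction, so \<open>T' T\<close> and \<open>T T'\<close> are both
  scalar; the two scalars agree and are nonzero, and comparing traces shows that the degrees agree.
\<close>

lemma (in group) intertwiner_zero_or_equivalent:
  assumes \<rho>: "unitary_rep G m \<rho>" "irreducible_rep G m \<rho>"
    and \<sigma>: "unitary_rep G n \<sigma>" "irreducible_rep G n \<sigma>"
    and T: "T \<in> carrier_mat n m"
    and inter: "\<And>x. x \<in> carrier G \<Longrightarrow> T * \<rho> x = \<sigma> x * T"
    and nz: "T \<noteq> 0\<^sub>m n m"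
  shows "equivalent_reps G m \<rho> n \<sigma>"
proof -
  define T' where "T' = mat_adjoint T"
  have T': "T' \<in> carrier_mat m n" using T unfolding T'_def by auto
  have inter': "T' * \<sigma> x = \<rho> x * T'" if x: "x \<in> carrier G" for x
  proof -
    have x': "inv x \<in> carrier G" using x by simp
    note R = unitary_repD(1)[OF \<rho>(1) x'] and S = unitary_repD(1)[OF \<sigma>(1) x']
    have "mat_adjoint (\<rho> (inv x)) * T' = mat_adjoint (T * \<rho> (inv x))"
      unfolding T'_def using mat_adjoint_mult[OF T R] by simp
    also have "\<dots> = mat_adjoint (\<sigma> (inv x) * T)" using inter[OF x'] by simp
    also have "\<dots> = T' * mat_adjoint (\<sigma> (inv x))"
      unfolding T'_def using mat_adjoint_mult[OF S T] by simp
    finally show ?thesis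
      using unitary_rep_inv[OF \<rho>(1) x'] unitary_rep_inv[OF \<sigma>(1) x'] x by simp
  qed
  have "(T' * T) * \<rho> x = \<rho> x * (T' * T)" if x: "x \<in> carrier G" for x
  proof -
    note R = unitary_repD(1)[OF \<rho>(1) x] and S = unitary_repD(1)[OF \<sigma>(1) x]
    show ?thesis
      using assoc_mult_mat[OF T' T R] assoc_mult_mat[OF T' S T] assoc_mult_mat[OF R T' T]
        inter[OF x] inter'[OF x] by simp
  qed
  then obtain a where a: "T' * T = a \<cdot>\<^sub>m 1\<^sub>m m"
    using commuting_scalar[OF \<rho> mult_carrier_mat[OF T' T]] by blast
  have "(T * T') * \<sigma> x = \<sigma> x * (T * T')" if x: "x \<in> carrier G" for x
  proof -
    note R = unitary_repD(1)[OF \<rho>(1) x] and S = unitary_repD(1)[OF \<sigma>(1) x]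
    show ?thesis
      using assoc_mult_mat[OF T T' S] assoc_mult_mat[OF T R T'] assoc_mult_mat[OF S T T']
        inter[OF x] inter'[OF x] by simp
  qed
  then obtain b where b: "T * T' = b \<cdot>\<^sub>m 1\<^sub>m n"
    using commuting_scalar[OF \<sigma> mult_carrier_mat[OF T T']] by blast
  have tr: "mtrace (T' * T) \<noteq> 0"
    using adjoint_mult_eq_zeroD[OF T] nz unfolding T'_def by blast
  hence a0: "a \<noteq> 0" unfolding a mtrace_smult_one by auto
  have "a \<cdot>\<^sub>m T = T * (T' * T)"
    unfolding a using T by (simp add: mult_smult_distrib[OF T one_carrier_mat])
  also have "\<dots> = (T * T') * T" using assoc_mult_mat[OF T T' T] by simp
  also have "\<dots> = b \<cdot>\<^sub>m T"
    unfolding b using T by (simp add: mult_smult_assoc_mat[OF one_carrier_mat T])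
  finally have eq: "a \<cdot>\<^sub>m T = b \<cdot>\<^sub>m T" .
  obtain i j where ij: "i < n" "j < m" "T $$ (i, j) \<noteq> 0"
    using nz T by (metis carrier_matD eq_matI index_zero_mat)
  have "(a \<cdot>\<^sub>m T) $$ (i, j) = (b \<cdot>\<^sub>m T) $$ (i, j)" using eq by simp
  hence ab: "a = b" using ij T by simp
  have "of_nat n * a = of_nat m * a"
    using mtrace_mult_comm[OF T T'] unfolding a b mtrace_smult_one ab by simp
  hence mn: "n = m" using a0 by simp
  have "invertible_mat T"
    unfolding invertible_mat_def inverts_mat_def
  proof (intro conjI exI)
    show "square_mat T" using T mn by simp
    show "T * (inverse a \<cdot>\<^sub>m T') = 1\<^sub>m (dim_row T)"
      using T b ab a0 by (auto simp: mult_smult_distrib[OF T T'] intro!: eq_matI)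
    show "(inverse a \<cdot>\<^sub>m T') * T = 1\<^sub>m (dim_row (inverse a \<cdot>\<^sub>m T'))"
      using T' a a0 by (auto simp: mult_smult_assoc_mat[OF T' T] intro!: eq_matI)
  qed
  thus ?thesis unfolding equivalent_reps_def using T inter by blast
qed

section \<open>Character relations\<close>

context group
begin

lemma sum_left_translate:
  assumes "z \<in> carrier G"
  shows "(\<Sum>y\<in>carrier G. h (z \<otimes> y)) = (\<Sum>y\<in>carrier G. h y)"
  by (rule sum.reindex_bij_witness[of _ "\<lambda>y. inv z \<otimes> y" "\<lambda>y. z \<otimes> y"])
    (use assms in \<open>auto simp: m_assoc[symmetric]\<close>)

lemma sum_right_translate:
  assumes "z \<in> carrier G"
  shows "(\<Sum>y\<in>carrier G. h (y \<otimes> z)) = (\<Sum>y\<in>carrier G. h y)"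
  by (rule sum.reindex_bij_witness[of _ "\<lambda>y. y \<otimes> inv z" "\<lambda>y. y \<otimes> z"])
    (use assms in \<open>auto simp: m_assoc\<close>)

lemma sum_inverse:
  "(\<Sum>y\<in>carrier G. h (inv y)) = (\<Sum>y\<in>carrier G. h y)"
  by (rule sum.reindex_bij_witness[of _ "\<lambda>y. inv y" "\<lambda>y. inv y"]) auto

lemma unitary_rep_mult_index:
  assumes \<rho>: "unitary_rep G n \<rho>" and "x \<in> carrier G" "y \<in> carrier G" "i < n" "j < n"
  shows "\<rho> (x \<otimes> y) $$ (i, j) = (\<Sum>c<n. \<rho> x $$ (i, c) * \<rho> y $$ (c, j))"
  using unitary_repD(4)[OF \<rho> assms(2,3)]
    mult_mat_index[OF unitary_repD(1)[OF \<rho> assms(2)] unitary_repD(1)[OF \<rho> assms(3)] assms(4,5)]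
  by simp

lemma mtrace_rep:
  assumes "unitary_rep G n \<rho>" "x \<in> carrier G"
  shows "mtrace (\<rho> x) = (\<Sum>i<n. \<rho> x $$ (i, i))"
  using unitary_repD(1)[OF assms] unfolding mtrace_def by simp

lemma mtrace_rep_mult_commute:
  assumes \<rho>: "unitary_rep G n \<rho>" and x: "x \<in> carrier G" and y: "y \<in> carrier G"
  shows "mtrace (\<rho> (x \<otimes> y)) = mtrace (\<rho> (y \<otimes> x))"
  using unitary_repD(4)[OF \<rho> x y] unitary_repD(4)[OF \<rho> y x]
    mtrace_mult_comm[OF unitary_repD(1)[OF \<rho> x] unitary_repD(1)[OF \<rho> y]] by simp

lemma mtrace_rep_inv:
  assumes \<rho>: "unitary_rep G n \<rho>" and x: "x \<in> carrier G"
  shows "mtrace (\<rho> (inv x)) = cnj (mtrace (\<rho> x))"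
proof -
  have "mtrace (\<rho> (inv x)) = (\<Sum>i<n. mat_adjoint (\<rho> x) $$ (i, i))"
    using mtrace_rep[OF \<rho> inv_closed[OF x]] unitary_rep_inv[OF \<rho> x] by simp
  also have "\<dots> = cnj (mtrace (\<rho> x))"
    by (simp add: mtrace_rep[OF \<rho> x] mat_adjoint_index[OF unitary_repD(1)[OF \<rho> x]])
  finally show ?thesis .
qed

text \<open>
  The average of the elementary matrix with its single entry in position \<open>(i, j)\<close>, that is, the
  sum over \<open>y\<close> of \<open>\<rho>(y) E \<sigma>(y\<^sup>-\<^sup>1)\<close>, written out entrywise and not divided by the group order.
\<close>

definition coeff_average ::
  "nat \<Rightarrow> ('a \<Rightarrow> complex mat) \<Rightarrow> nat \<Rightarrow> ('a \<Rightarrow> complex mat) \<Rightarrow> nat \<Rightarrow> nat \<Rightarrow> complex mat" where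
  "coeff_average m \<rho> n \<sigma> i j =
     mat m n (\<lambda>(a, b). \<Sum>y\<in>carrier G. \<rho> y $$ (a, i) * \<sigma> (inv y) $$ (j, b))"

lemma coeff_average_carrier: "coeff_average m \<rho> n \<sigma> i j \<in> carrier_mat m n"
  unfolding coeff_average_def by simp

lemma coeff_average_intertwines:
  assumes \<rho>: "unitary_rep G m \<rho>" and \<sigma>: "unitary_rep G n \<sigma>"
    and z: "z \<in> carrier G" and i: "i < m" and j: "j < n"
  shows "coeff_average m \<rho> n \<sigma> i j * \<sigma> z = \<rho> z * coeff_average m \<rho> n \<sigma> i j"
    (is "?T * _ = _")
proof (rule eq_matI)
  note T = coeff_average_carrier[of m \<rho> n \<sigma> i j]
  note R = unitary_repD(1)[OF \<rho> z] and S = unitary_repD(1)[OF \<sigma> z]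
  fix a b assume "a < dim_row (\<rho> z * ?T)" "b < dim_col (\<rho> z * ?T)"
  hence a: "a < m" and b: "b < n" using T R by auto
  have "(\<rho> z * ?T) $$ (a, b) =
      (\<Sum>c<m. \<rho> z $$ (a, c) * (\<Sum>y\<in>carrier G. \<rho> y $$ (c, i) * \<sigma> (inv y) $$ (j, b)))"
    unfolding mult_mat_index[OF R T a b] using b by (simp add: coeff_average_def)
  also have "\<dots> = (\<Sum>y\<in>carrier G. (\<Sum>c<m. \<rho> z $$ (a, c) * \<rho> y $$ (c, i)) * \<sigma> (inv y) $$ (j, b))"
    unfolding sum_distrib_left sum_distrib_right by (subst sum.swap) (simp add: mult.assoc)
  also have "\<dots> = (\<Sum>y\<in>carrier G. \<rho> (z \<otimes> y) $$ (a, i) * \<sigma> (inv y) $$ (j, b))"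
    by (intro sum.cong refl) (simp add: unitary_rep_mult_index[OF \<rho> z _ a i])
  also have "\<dots> = (\<Sum>y\<in>carrier G. \<rho> (z \<otimes> y) $$ (a, i) * \<sigma> (inv (z \<otimes> y) \<otimes> z) $$ (j, b))"
    using z by (intro sum.cong refl) (simp add: inv_mult_group m_assoc)
  also have "\<dots> = (\<Sum>y\<in>carrier G. \<rho> y $$ (a, i) * \<sigma> (inv y \<otimes> z) $$ (j, b))"
    by (rule sum_left_translate[OF z])
  also have "\<dots> = (\<Sum>y\<in>carrier G. \<rho> y $$ (a, i) * (\<Sum>c<n. \<sigma> (inv y) $$ (j, c) * \<sigma> z $$ (c, b)))"
    by (intro sum.cong refl) (simp add: unitary_rep_mult_index[OF \<sigma> inv_closed z j b])
  also have "\<dots> = (\<Sum>c<n. (\<Sum>y\<in>carrier G. \<rho> y $$ (a, i) * \<sigma> (inv y) $$ (j, c)) * \<sigma> z $$ (c, b))"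
    unfolding sum_distrib_left sum_distrib_right by (subst sum.swap) (simp add: mult.assoc)
  also have "\<dots> = (?T * \<sigma> z) $$ (a, b)"
    unfolding mult_mat_index[OF T S a b] using a by (simp add: coeff_average_def)
  finally show "(?T * \<sigma> z) $$ (a, b) = (\<rho> z * ?T) $$ (a, b)" ..
qed (use coeff_average_carrier[of m \<rho> n \<sigma> i j] unitary_repD(1)[OF \<rho> z] unitary_repD(1)[OF \<sigma> z]
    in auto)

lemma character_orthogonal:
  assumes \<rho>: "unitary_rep G m \<rho>" "irreducible_rep G m \<rho>"
    and \<sigma>: "unitary_rep G n \<sigma>" "irreducible_rep G n \<sigma>"
    and neq: "\<not> equivalent_reps G n \<sigma> m \<rho>"
  shows "(\<Sum>y\<in>carrier G. mtrace (\<rho> y) * mtrace (\<sigma> (inv y))) = 0"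
proof -
  have coeff: "(\<Sum>y\<in>carrier G. \<rho> y $$ (i, i) * \<sigma> (inv y) $$ (j, j)) = 0" if ij: "i < m" "j < n" for i j
  proof -
    have "coeff_average m \<rho> n \<sigma> i j = 0\<^sub>m m n"
      using intertwiner_zero_or_equivalent[OF \<sigma> \<rho> coeff_average_carrier
          coeff_average_intertwines[OF \<rho>(1) \<sigma>(1) _ ij]] neq by blast
    hence "coeff_average m \<rho> n \<sigma> i j $$ (i, j) = 0" using ij by simp
    thus ?thesis using ij by (simp add: coeff_average_def)
  qed
  have "(\<Sum>y\<in>carrier G. mtrace (\<rho> y) * mtrace (\<sigma> (inv y))) =
      (\<Sum>y\<in>carrier G. \<Sum>i<m. \<Sum>j<n. \<rho> y $$ (i, i) * \<sigma> (inv y) $$ (j, j))"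
    by (intro sum.cong refl)
      (simp add: mtrace_rep[OF \<rho>(1)] mtrace_rep[OF \<sigma>(1)] sum_product)
  also have "\<dots> = (\<Sum>i<m. \<Sum>j<n. \<Sum>y\<in>carrier G. \<rho> y $$ (i, i) * \<sigma> (inv y) $$ (j, j))"
    by (subst sum.swap) (intro sum.cong refl sum.swap)
  also have "\<dots> = 0" by (simp add: coeff)
  finally show ?thesis .
qed

lemma character_norm:
  assumes \<rho>: "unitary_rep G n \<rho>" "irreducible_rep G n \<rho>"
  shows "(\<Sum>y\<in>carrier G. mtrace (\<rho> y) * mtrace (\<rho> (inv y))) = of_nat (Coset.order G)"
proof -
  have n: "n > 0" using \<rho>(2) unfolding irreducible_rep_def by simp
  have coeff: "(\<Sum>y\<in>carrier G. \<rho> y $$ (i, i) * \<rho> (inv y) $$ (j, j)) =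
      (if i = j then of_nat (Coset.order G) / of_nat n else 0)" if ij: "i < n" "j < n" for i j
  proof -
    let ?T = "coeff_average n \<rho> n \<rho> i j"
    obtain c where c: "?T = c \<cdot>\<^sub>m 1\<^sub>m n"
      using commuting_scalar[OF \<rho> coeff_average_carrier coeff_average_intertwines[OF \<rho>(1) \<rho>(1) _ ij]]
      by blast
    have "of_nat n * c = (\<Sum>a<n. \<Sum>y\<in>carrier G. \<rho> y $$ (a, i) * \<rho> (inv y) $$ (j, a))"
      using mtrace_smult_one[of c n] unfolding c[symmetric] by (simp add: mtrace_def coeff_average_def)
    also have "\<dots> = (\<Sum>y\<in>carrier G. \<Sum>a<n. \<rho> (inv y) $$ (j, a) * \<rho> y $$ (a, i))"
      by (subst sum.swap) (simp add: mult.commute)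
    also have "\<dots> = (\<Sum>y\<in>carrier G. 1\<^sub>m n $$ (j, i))"
      using unitary_rep_one[OF \<rho>(1)]
      by (intro sum.cong refl)
        (simp add: unitary_rep_mult_index[OF \<rho>(1) inv_closed _ ij(2,1), symmetric])
    also have "\<dots> = (if i = j then of_nat (Coset.order G) else 0)"
      using ij by (auto simp: Coset.order_def)
    finally have "c = (if i = j then of_nat (Coset.order G) / of_nat n else 0)"
      using n by (auto simp: field_simps split: if_splits)
    moreover have "(\<Sum>y\<in>carrier G. \<rho> y $$ (i, i) * \<rho> (inv y) $$ (j, j)) = ?T $$ (i, j)"
      using ij by (simp add: coeff_average_def)
    ultimately show ?thesis using ij unfolding c by simp
  qed
  have "(\<Sum>y\<in>carrier G. mtrace (\<rho> y) * mtrace (\<rho> (inv y))) =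
      (\<Sum>y\<in>carrier G. \<Sum>i<n. \<Sum>j<n. \<rho> y $$ (i, i) * \<rho> (inv y) $$ (j, j))"
    by (intro sum.cong refl)
      (simp add: mtrace_rep[OF \<rho>(1)] sum_product)
  also have "\<dots> = (\<Sum>i<n. \<Sum>j<n. \<Sum>y\<in>carrier G. \<rho> y $$ (i, i) * \<rho> (inv y) $$ (j, j))"
    by (subst sum.swap) (intro sum.cong refl sum.swap)
  also have "\<dots> = of_nat (Coset.order G)" using n by (simp add: coeff)
  finally show ?thesis .
qed

text \<open>
  The sum over \<open>y\<close> of \<open>\<chi>(y) \<sigma>(y\<^sup>-\<^sup>1)\<close>, with \<open>\<chi>\<close> the character of \<open>\<rho>\<close>, commutes with \<open>\<sigma>\<close> because
  \<open>\<chi>\<close> is a class function. Hence it is a scalar, whose value is read off from its trace.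
  Only \<open>\<sigma>\<close> has to be irreducible.
\<close>

lemma character_convolution:
  assumes \<rho>: "unitary_rep G m \<rho>" and \<sigma>: "unitary_rep G n \<sigma>" "irreducible_rep G n \<sigma>"
    and x: "x \<in> carrier G"
  shows "of_nat n * (\<Sum>y\<in>carrier G. mtrace (\<rho> y) * mtrace (\<sigma> (inv y \<otimes> x))) =
    (\<Sum>y\<in>carrier G. mtrace (\<rho> y) * mtrace (\<sigma> (inv y))) * mtrace (\<sigma> x)"
proof -
  define M where "M = mat n n (\<lambda>(a, b). \<Sum>y\<in>carrier G. mtrace (\<rho> y) * \<sigma> (inv y) $$ (a, b))"
  have M: "M \<in> carrier_mat n n" unfolding M_def by simp
  have M_left: "(M * \<sigma> z) $$ (a, b) = (\<Sum>y\<in>carrier G. mtrace (\<rho> y) * \<sigma> (inv y \<otimes> z) $$ (a, b))"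
    if z: "z \<in> carrier G" and ab: "a < n" "b < n" for z a b
  proof -
    have "(M * \<sigma> z) $$ (a, b) =
        (\<Sum>c<n. (\<Sum>y\<in>carrier G. mtrace (\<rho> y) * \<sigma> (inv y) $$ (a, c)) * \<sigma> z $$ (c, b))"
      unfolding mult_mat_index[OF M unitary_repD(1)[OF \<sigma>(1) z] ab] using ab by (simp add: M_def)
    also have "\<dots> = (\<Sum>y\<in>carrier G. mtrace (\<rho> y) * (\<Sum>c<n. \<sigma> (inv y) $$ (a, c) * \<sigma> z $$ (c, b)))"
      unfolding sum_distrib_left sum_distrib_right by (subst sum.swap) (simp add: mult.assoc)
    also have "\<dots> = (\<Sum>y\<in>carrier G. mtrace (\<rho> y) * \<sigma> (inv y \<otimes> z) $$ (a, b))"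
      by (intro sum.cong refl) (simp add: unitary_rep_mult_index[OF \<sigma>(1) inv_closed z ab])
    finally show ?thesis .
  qed
  have M_right: "(\<sigma> z * M) $$ (a, b) = (\<Sum>y\<in>carrier G. mtrace (\<rho> y) * \<sigma> (z \<otimes> inv y) $$ (a, b))"
    if z: "z \<in> carrier G" and ab: "a < n" "b < n" for z a b
  proof -
    have "(\<sigma> z * M) $$ (a, b) =
        (\<Sum>c<n. \<sigma> z $$ (a, c) * (\<Sum>y\<in>carrier G. mtrace (\<rho> y) * \<sigma> (inv y) $$ (c, b)))"
      unfolding mult_mat_index[OF unitary_repD(1)[OF \<sigma>(1) z] M ab] using ab by (simp add: M_def)
    also have "\<dots> = (\<Sum>y\<in>carrier G. mtrace (\<rho> y) * (\<Sum>c<n. \<sigma> z $$ (a, c) * \<sigma> (inv y) $$ (c, b)))"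
      unfolding sum_distrib_left sum_distrib_right by (subst sum.swap) (simp add: mult_ac)
    also have "\<dots> = (\<Sum>y\<in>carrier G. mtrace (\<rho> y) * \<sigma> (z \<otimes> inv y) $$ (a, b))"
      by (intro sum.cong refl) (simp add: unitary_rep_mult_index[OF \<sigma>(1) z inv_closed ab])
    finally show ?thesis .
  qed
  have "M * \<sigma> z = \<sigma> z * M" if z: "z \<in> carrier G" for z
  proof (rule eq_matI)
    note S = unitary_repD(1)[OF \<sigma>(1) z]
    fix a b assume "a < dim_row (\<sigma> z * M)" "b < dim_col (\<sigma> z * M)"
    hence ab: "a < n" "b < n" using M S by auto
    \<comment> \<open>Substitute the conjugate of \<open>y\<close> by \<open>z\<close> for \<open>y\<close>.\<close>
    have "(M * \<sigma> z) $$ (a, b) =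
        (\<Sum>y\<in>carrier G. mtrace (\<rho> (z \<otimes> (y \<otimes> inv z))) * \<sigma> (inv (z \<otimes> (y \<otimes> inv z)) \<otimes> z) $$ (a, b))"
      unfolding M_left[OF z ab]
      using sum_left_translate[OF z, of "\<lambda>y. mtrace (\<rho> y) * \<sigma> (inv y \<otimes> z) $$ (a, b)"]
        sum_right_translate[OF inv_closed[OF z],
          of "\<lambda>y. mtrace (\<rho> (z \<otimes> y)) * \<sigma> (inv (z \<otimes> y) \<otimes> z) $$ (a, b)"]
      by simp
    also have "\<dots> = (\<Sum>y\<in>carrier G. mtrace (\<rho> y) * \<sigma> (z \<otimes> inv y) $$ (a, b))"
    proof (intro sum.cong refl)
      fix y assume y: "y \<in> carrier G"
      have "mtrace (\<rho> (z \<otimes> (y \<otimes> inv z))) = mtrace (\<rho> (y \<otimes> inv z \<otimes> z))"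
        using mtrace_rep_mult_commute[OF \<rho>] y z by simp
      also have "y \<otimes> inv z \<otimes> z = y" using y z by (simp add: m_assoc)
      finally have "mtrace (\<rho> (z \<otimes> (y \<otimes> inv z))) = mtrace (\<rho> y)" .
      moreover have "inv (z \<otimes> (y \<otimes> inv z)) \<otimes> z = z \<otimes> inv y"
        using y z by (simp add: inv_mult_group m_assoc)
      ultimately show "mtrace (\<rho> (z \<otimes> (y \<otimes> inv z))) * \<sigma> (inv (z \<otimes> (y \<otimes> inv z)) \<otimes> z) $$ (a, b) =
          mtrace (\<rho> y) * \<sigma> (z \<otimes> inv y) $$ (a, b)" by simp
    qed
    also have "\<dots> = (\<sigma> z * M) $$ (a, b)" using M_right[OF z ab] by simp
    finally show "(M * \<sigma> z) $$ (a, b) = (\<sigma> z * M) $$ (a, b)" .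
  qed (use M unitary_repD(1)[OF \<sigma>(1) z] in auto)
  then obtain c where c: "M = c \<cdot>\<^sub>m 1\<^sub>m n"
    using commuting_scalar[OF \<sigma> M] by blast
  have "of_nat n * c = (\<Sum>a<n. \<Sum>y\<in>carrier G. mtrace (\<rho> y) * \<sigma> (inv y) $$ (a, a))"
    using mtrace_smult_one[of c n] unfolding c[symmetric] by (simp add: mtrace_def M_def)
  also have "\<dots> = (\<Sum>y\<in>carrier G. mtrace (\<rho> y) * mtrace (\<sigma> (inv y)))"
    by (subst sum.swap) (simp add: mtrace_rep[OF \<sigma>(1)] sum_distrib_left)
  finally have tr: "of_nat n * c = (\<Sum>y\<in>carrier G. mtrace (\<rho> y) * mtrace (\<sigma> (inv y)))" .
  have "(\<Sum>y\<in>carrier G. mtrace (\<rho> y) * mtrace (\<sigma> (inv y \<otimes> x))) =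
      (\<Sum>a<n. \<Sum>y\<in>carrier G. mtrace (\<rho> y) * \<sigma> (inv y \<otimes> x) $$ (a, a))"
    using x by (subst sum.swap) (simp add: mtrace_rep[OF \<sigma>(1)] sum_distrib_left)
  also have "\<dots> = (\<Sum>a<n. (M * \<sigma> x) $$ (a, a))" using M_left[OF x] by simp
  also have "M * \<sigma> x = c \<cdot>\<^sub>m \<sigma> x"
    unfolding c using unitary_repD(1)[OF \<sigma>(1) x]
    by (simp add: mult_smult_assoc_mat[OF one_carrier_mat])
  also have "(\<Sum>a<n. (c \<cdot>\<^sub>m \<sigma> x) $$ (a, a)) = c * mtrace (\<sigma> x)"
    using unitary_repD(1)[OF \<sigma>(1) x] by (simp add: mtrace_def sum_distrib_left)
  finally show ?thesis using tr by (simp add: mult.assoc[symmetric])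
qed

end

section \<open>The inner product and convolution on functions on a group\<close>

lemma L2_norm_square:
  "(L2_norm G f)\<^sup>2 = (1 / real (Coset.order G)) * (\<Sum>x\<in>carrier G. (cmod (f x))\<^sup>2)"
proof -
  have "L2_inner G f f = complex_of_real ((1 / real (Coset.order G)) * (\<Sum>x\<in>carrier G. (cmod (f x))\<^sup>2))"
    unfolding L2_inner_def by (simp add: complex_norm_square del: of_real_power)
  hence "Re (L2_inner G f f) = (1 / real (Coset.order G)) * (\<Sum>x\<in>carrier G. (cmod (f x))\<^sup>2)"
    by (metis Re_complex_of_real)
  thus ?thesis unfolding L2_norm_def by (simp add: sum_nonneg)
qed

lemma L2_inner_self: "L2_inner G f f = complex_of_real ((L2_norm G f)\<^sup>2)"
  unfolding L2_norm_square L2_inner_def by (simp add: complex_norm_square del: of_real_power)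

lemma L2_norm_nonneg: "L2_norm G f \<ge> 0"
proof -
  have "Re (L2_inner G f f) = (L2_norm G f)\<^sup>2" by (simp add: L2_inner_self)
  hence "Re (L2_inner G f f) \<ge> 0" by (simp only: zero_le_power2)
  thus ?thesis unfolding L2_norm_def by simp
qed

lemma L2_norm_square_mono:
  assumes "\<And>x. x \<in> carrier G \<Longrightarrow> cmod (f x) \<le> cmod (g x)"
  shows "(L2_norm G f)\<^sup>2 \<le> (L2_norm G g)\<^sup>2"
  unfolding L2_norm_square using assms
  by (intro mult_left_mono sum_mono power_mono) auto

lemma L2_inner_cong:
  assumes "\<And>x. x \<in> carrier G \<Longrightarrow> f x = f' x" "\<And>x. x \<in> carrier G \<Longrightarrow> g x = g' x"
  shows "L2_inner G f g = L2_inner G f' g'"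
  unfolding L2_inner_def using assms by simp

lemma L2_inner_commute: "L2_inner G g f = cnj (L2_inner G f g)"
  unfolding L2_inner_def by (simp add: mult.commute)

lemma L2_inner_sum_left:
  "L2_inner G (\<lambda>x. \<Sum>r\<in>A. a r * u r x) g = (\<Sum>r\<in>A. a r * L2_inner G (u r) g)"
  unfolding L2_inner_def
  by (simp add: sum_distrib_left sum_distrib_right sum.swap[of _ A] mult_ac)

lemma L2_inner_sum_right:
  "L2_inner G g (\<lambda>x. \<Sum>r\<in>A. a r * u r x) = (\<Sum>r\<in>A. cnj (a r) * L2_inner G g (u r))"
  by (subst L2_inner_commute) (simp add: L2_inner_sum_left L2_inner_commute[of G "u _" g])

lemma L2_norm_square_diff:
  "(L2_norm G (\<lambda>x. f x - g x))\<^sup>2 =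
     (L2_norm G f)\<^sup>2 - 2 * Re (L2_inner G f g) + (L2_norm G g)\<^sup>2"
proof -
  have "complex_of_real ((L2_norm G (\<lambda>x. f x - g x))\<^sup>2) =
      L2_inner G f f - L2_inner G f g - L2_inner G g f + L2_inner G g g"
    unfolding L2_inner_self[symmetric] unfolding L2_inner_def
    by (simp add: algebra_simps sum.distrib sum_subtractf)
  also have "\<dots> = complex_of_real ((L2_norm G f)\<^sup>2 - 2 * Re (L2_inner G f g) + (L2_norm G g)\<^sup>2)"
    unfolding L2_inner_self L2_inner_commute[of G g f]
    by (simp add: complex_eq_iff)
  finally show ?thesis by (simp only: of_real_eq_iff)
qed

lemma convol_diff: "convol G e (\<lambda>x. f x - g x) x = convol G e f x - convol G e g x"
  unfolding convol_def by (simp add: sum_subtractf algebra_simps)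

context group
begin

lemma convol_assoc:
  assumes x: "x \<in> carrier G"
  shows "convol G e (convol G e' g) x = convol G (convol G e e') g x"
proof -
  have shift: "(\<Sum>z\<in>carrier G. e' (inv y \<otimes> z) * g (inv z \<otimes> x)) =
      (\<Sum>z\<in>carrier G. e' z * g (inv z \<otimes> (inv y \<otimes> x)))" if y: "y \<in> carrier G" for y
  proof -
    have "(\<Sum>z\<in>carrier G. e' (inv y \<otimes> z) * g (inv z \<otimes> x)) =
        (\<Sum>z\<in>carrier G. e' (inv y \<otimes> (y \<otimes> z)) * g (inv (y \<otimes> z) \<otimes> x))"
      by (rule sum_left_translate[OF y, symmetric])
    also have "\<dots> = (\<Sum>z\<in>carrier G. e' z * g (inv z \<otimes> (inv y \<otimes> x)))"
      using x y by (intro sum.cong refl) (simp add: m_assoc[symmetric] inv_mult_group)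
    finally show ?thesis .
  qed
  have "(\<Sum>z\<in>carrier G. (\<Sum>y\<in>carrier G. e y * e' (inv y \<otimes> z)) * g (inv z \<otimes> x)) =
      (\<Sum>y\<in>carrier G. e y * (\<Sum>z\<in>carrier G. e' (inv y \<otimes> z) * g (inv z \<otimes> x)))"
    unfolding sum_distrib_left sum_distrib_right by (subst sum.swap) (simp add: mult.assoc)
  also have "\<dots> = (\<Sum>y\<in>carrier G. e y * (\<Sum>z\<in>carrier G. e' z * g (inv z \<otimes> (inv y \<otimes> x))))"
    by (simp add: shift)
  finally show ?thesis
    unfolding convol_def by (simp add: sum_distrib_left[symmetric] sum_divide_distrib[symmetric] mult_ac)
qed

lemma L2_inner_convol_adjoint:
  assumes e: "\<And>y. y \<in> carrier G \<Longrightarrow> e (inv y) = cnj (e y)"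
  shows "L2_inner G (convol G e g) h = L2_inner G g (convol G e h)"
proof -
  have shift: "(\<Sum>x\<in>carrier G. g (y \<otimes> x) * cnj (h x)) =
      (\<Sum>x\<in>carrier G. g x * cnj (h (inv y \<otimes> x)))" if y: "y \<in> carrier G" for y
  proof -
    have "(\<Sum>x\<in>carrier G. g (y \<otimes> x) * cnj (h x)) =
        (\<Sum>x\<in>carrier G. g (y \<otimes> (inv y \<otimes> x)) * cnj (h (inv y \<otimes> x)))"
      by (rule sum_left_translate[OF inv_closed[OF y], symmetric])
    also have "\<dots> = (\<Sum>x\<in>carrier G. g x * cnj (h (inv y \<otimes> x)))"
      using y by (intro sum.cong refl) (simp add: m_assoc[symmetric])
    finally show ?thesis .
  qed
  have "(\<Sum>x\<in>carrier G. (\<Sum>y\<in>carrier G. e y * g (inv y \<otimes> x)) * cnj (h x)) =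
      (\<Sum>y\<in>carrier G. e y * (\<Sum>x\<in>carrier G. g (inv y \<otimes> x) * cnj (h x)))"
    unfolding sum_distrib_left sum_distrib_right by (subst sum.swap) (simp add: mult.assoc)
  also have "\<dots> = (\<Sum>y\<in>carrier G. e (inv y) * (\<Sum>x\<in>carrier G. g (inv (inv y) \<otimes> x) * cnj (h x)))"
    by (rule sum_inverse[symmetric])
  also have "\<dots> = (\<Sum>y\<in>carrier G. cnj (e y) * (\<Sum>x\<in>carrier G. g x * cnj (h (inv y \<otimes> x))))"
    by (simp add: e shift)
  also have "\<dots> = (\<Sum>x\<in>carrier G. g x * cnj (\<Sum>y\<in>carrier G. e y * h (inv y \<otimes> x)))"
    by (simp add: sum_distrib_left, subst sum.swap) (simp add: mult_ac)
  finally show ?thesis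
    unfolding convol_def L2_inner_def by (simp add: sum_divide_distrib[symmetric])
qed

section \<open>The Littlewood-Paley inequality\<close>

text \<open>
  Convolution with the functions \<open>e r\<close> gives mutually orthogonal orthogonal projections; applying
  operators that are diagonal with respect to them, with weights whose squared moduli sum to at
  most \<open>1\<close> on each range, does not increase the total energy.
\<close>

lemma convol_idempotents_bessel:
  fixes e :: "nat \<Rightarrow> 'a \<Rightarrow> complex" and \<gamma> :: "nat \<Rightarrow> nat \<Rightarrow> complex"
  assumes fin: "finite A"
    and herm: "\<And>r y. r \<in> A \<Longrightarrow> y \<in> carrier G \<Longrightarrow> e r (inv y) = cnj (e r y)"
    and idem: "\<And>r s y. r \<in> A \<Longrightarrow> s \<in> A \<Longrightarrow> y \<in> carrier G \<Longrightarrow>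
      convol G (e r) (e s) y = (if r = s then e r y else 0)"
    and \<gamma>: "\<And>r. r \<in> A \<Longrightarrow> (\<Sum>j\<in>B. (cmod (\<gamma> j r))\<^sup>2) \<le> 1"
  shows "(\<Sum>j\<in>B. (L2_norm G (convol G (\<lambda>x. \<Sum>r\<in>A. \<gamma> j r * e r x) g))\<^sup>2) \<le> (L2_norm G g)\<^sup>2"
proof -
  define P where "P r = convol G (e r) g" for r
  have orth: "L2_inner G (P r) (P s) = (if r = s then L2_inner G g (P r) else 0)"
    if rs: "r \<in> A" "s \<in> A" for r s
  proof -
    have "L2_inner G (P r) (P s) = L2_inner G g (convol G (e r) (P s))"
      unfolding P_def by (rule L2_inner_convol_adjoint) (rule herm[OF rs(1)])
    also have "\<dots> = L2_inner G g (if r = s then P r else (\<lambda>_. 0))"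
    proof (rule L2_inner_cong)
      fix x assume x: "x \<in> carrier G"
      have "convol G (e r) (P s) x = convol G (convol G (e r) (e s)) g x"
        unfolding P_def by (rule convol_assoc[OF x])
      also have "\<dots> = (if r = s then P r else (\<lambda>_. 0)) x"
        unfolding P_def convol_def[of G _ g] by (auto simp: idem[OF rs])
      finally show "convol G (e r) (P s) x = (if r = s then P r else (\<lambda>_. 0)) x" .
    qed simp
    also have "\<dots> = (if r = s then L2_inner G g (P r) else 0)"
      by (auto simp: L2_inner_def)
    finally show ?thesis .
  qed
  have pythagoras: "(L2_norm G (\<lambda>x. \<Sum>r\<in>A. a r * P r x))\<^sup>2 =
      (\<Sum>r\<in>A. (cmod (a r))\<^sup>2 * (L2_norm G (P r))\<^sup>2)" for a :: "nat \<Rightarrow> complex"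
  proof -
    have "complex_of_real ((L2_norm G (\<lambda>x. \<Sum>r\<in>A. a r * P r x))\<^sup>2) =
        (\<Sum>r\<in>A. a r * (\<Sum>s\<in>A. cnj (a s) * L2_inner G (P r) (P s)))"
      unfolding L2_inner_self[symmetric] L2_inner_sum_left L2_inner_sum_right ..
    also have "\<dots> = (\<Sum>r\<in>A. a r * (\<Sum>s\<in>A. if s = r then cnj (a r) * L2_inner G (P r) (P r) else 0))"
      by (intro sum.cong refl arg_cong2[where f = "(*)"]) (auto simp: orth)
    also have "\<dots> = (\<Sum>r\<in>A. a r * (cnj (a r) * L2_inner G (P r) (P r)))"
      using fin by simp
    also have "\<dots> = complex_of_real (\<Sum>r\<in>A. (cmod (a r))\<^sup>2 * (L2_norm G (P r))\<^sup>2)"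
      by (simp add: L2_inner_self complex_norm_square[symmetric] mult.assoc[symmetric] del: of_real_power)
    finally show ?thesis by (simp only: of_real_eq_iff)
  qed
  have bessel: "(\<Sum>r\<in>A. (L2_norm G (P r))\<^sup>2) \<le> (L2_norm G g)\<^sup>2"
  proof -
    let ?Q = "\<lambda>x. \<Sum>r\<in>A. 1 * P r x"
    have "L2_inner G g ?Q = (\<Sum>r\<in>A. L2_inner G (P r) (P r))"
      unfolding L2_inner_sum_right by (simp add: orth)
    hence "Re (L2_inner G g ?Q) = (\<Sum>r\<in>A. (L2_norm G (P r))\<^sup>2)"
      by (simp add: L2_inner_self del: of_real_power)
    moreover have "(L2_norm G ?Q)\<^sup>2 = (\<Sum>r\<in>A. (L2_norm G (P r))\<^sup>2)"
      using pythagoras[of "\<lambda>_. 1"] by simp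
    ultimately have "(L2_norm G (\<lambda>x. g x - ?Q x))\<^sup>2 =
        (L2_norm G g)\<^sup>2 - (\<Sum>r\<in>A. (L2_norm G (P r))\<^sup>2)"
      unfolding L2_norm_square_diff by simp
    thus ?thesis using zero_le_power2[of "L2_norm G (\<lambda>x. g x - ?Q x)"] by linarith
  qed
  have "convol G (\<lambda>x. \<Sum>r\<in>A. \<gamma> j r * e r x) g = (\<lambda>x. \<Sum>r\<in>A. \<gamma> j r * P r x)" for j
    unfolding P_def convol_def
    by (rule ext) (simp add: sum_distrib_left sum_distrib_right sum.swap[of _ A] mult_ac)
  hence "(\<Sum>j\<in>B. (L2_norm G (convol G (\<lambda>x. \<Sum>r\<in>A. \<gamma> j r * e r x) g))\<^sup>2) =
      (\<Sum>r\<in>A. (\<Sum>j\<in>B. (cmod (\<gamma> j r))\<^sup>2) * (L2_norm G (P r))\<^sup>2)"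
    by (simp add: pythagoras sum_distrib_right sum.swap[of _ A])
  also have "\<dots> \<le> (\<Sum>r\<in>A. 1 * (L2_norm G (P r))\<^sup>2)"
    using \<gamma> by (intro sum_mono mult_right_mono) auto
  also have "\<dots> \<le> (L2_norm G g)\<^sup>2" using bessel by simp
  finally show ?thesis .
qed

text \<open>
  Up to the degree, irreducible characters are orthogonal convolution idempotents. With the
  normalised convolution, the factor \<open>d\<^sub>r\<close> is what makes \<open>d\<^sub>r \<chi>\<^sup>r\<close> an idempotent.
\<close>

lemma irrep_kernel_convol:
  assumes sys: "complete_irrep_system G k d \<pi>" and fin: "finite (carrier G)"
    and r: "r \<in> {1..k}" and s: "s \<in> {1..k}" and x: "x \<in> carrier G"
  shows "convol G (\<lambda>x. of_nat (d r) * mtrace (\<pi> r x)) (\<lambda>x. of_nat (d s) * mtrace (\<pi> s x)) x =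
    (if r = s then of_nat (d r) * mtrace (\<pi> r x) else 0)"
proof -
  have rep: "unitary_rep G (d q) (\<pi> q)" "irreducible_rep G (d q) (\<pi> q)" if "q \<in> {1..k}" for q
    using sys that unfolding complete_irrep_system_def by auto
  have N: "(of_nat (Coset.order G) :: complex) \<noteq> 0"
    using fin order_gt_0_iff_finite by simp
  let ?S = "\<Sum>y\<in>carrier G. mtrace (\<pi> r y) * mtrace (\<pi> s (inv y))"
  have "convol G (\<lambda>x. of_nat (d r) * mtrace (\<pi> r x)) (\<lambda>x. of_nat (d s) * mtrace (\<pi> s x)) x =
      of_nat (d r) / of_nat (Coset.order G) *
      (of_nat (d s) * (\<Sum>y\<in>carrier G. mtrace (\<pi> r y) * mtrace (\<pi> s (inv y \<otimes> x))))"
    unfolding convol_def by (simp add: sum_distrib_left mult_ac)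
  also have "\<dots> = of_nat (d r) / of_nat (Coset.order G) * (?S * mtrace (\<pi> s x))"
    using character_convolution[OF rep(1)[OF r] rep[OF s] x] by simp
  also have "?S = (if r = s then of_nat (Coset.order G) else 0)"
  proof (cases "r = s")
    case True
    thus ?thesis using character_norm[OF rep[OF r]] by simp
  next
    case False
    hence "\<not> equivalent_reps G (d s) (\<pi> s) (d r) (\<pi> r)"
      using sys r s unfolding complete_irrep_system_def by auto
    thus ?thesis using False character_orthogonal[OF rep[OF r] rep[OF s]] by simp
  qed
  finally show ?thesis using N by auto
qed

lemma wavelet_bessel:
  assumes sys: "complete_irrep_system G k d \<pi>" and fin: "finite (carrier G)"
    and \<gamma>: "\<And>r. r \<in> {1..k} \<Longrightarrow> (\<Sum>j\<in>B. (cmod (\<gamma> j r))\<^sup>2) \<le> 1"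
  shows "(\<Sum>j\<in>B. (L2_norm G (convol G (wavelet k d \<pi> \<gamma> j) g))\<^sup>2) \<le> (L2_norm G g)\<^sup>2"
proof -
  define e where "e r x = of_nat (d r) * mtrace (\<pi> r x)" for r x
  have w: "wavelet k d \<pi> \<gamma> j = (\<lambda>x. \<Sum>r\<in>{1..k}. \<gamma> j r * e r x)" for j
    unfolding wavelet_def e_def by (rule ext) (simp add: mult_ac)
  show ?thesis unfolding w
  proof (rule convol_idempotents_bessel)
    show "e r (inv y) = cnj (e r y)" if "r \<in> {1..k}" "y \<in> carrier G" for r y
      using sys that mtrace_rep_inv[of "d r" "\<pi> r" y]
      unfolding complete_irrep_system_def e_def by auto
    show "convol G (e r) (e s) y = (if r = s then e r y else 0)"
      if "r \<in> {1..k}" "s \<in> {1..k}" "y \<in> carrier G" for r s y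
      unfolding e_def by (rule irrep_kernel_convol[OF sys fin that])
  qed (use \<gamma> in auto)
qed

end

section \<open>Energy of the scattering transform\<close>

text \<open>
  Any filters satisfying the Littlewood-Paley inequality will do. The functions \<open>f\<close> and \<open>f'\<close> vary
  in the induction, because a path \<open>j # p\<close> scatters the moduli of \<open>\<psi> j * f\<close> and
  \<open>\<psi> j * f'\<close> along \<open>p\<close>.
\<close>

lemma scatter_prop_contraction:
  fixes \<psi> :: "nat \<Rightarrow> 'a \<Rightarrow> complex" and f f' :: "'a \<Rightarrow> complex"
  assumes bessel: "\<And>g. (\<Sum>j\<in>{0..J}. (L2_norm G (convol G (\<psi> j) g))\<^sup>2) \<le> (L2_norm G g)\<^sup>2"
  shows "(\<Sum>p\<in>{p. set p \<subseteq> {1..J} \<and> length p \<le> m}.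
      (L2_norm G (\<lambda>x. convol G (\<psi> 0) (scatter_prop G \<psi> p f) x
        - convol G (\<psi> 0) (scatter_prop G \<psi> p f') x))\<^sup>2) \<le> (L2_norm G (\<lambda>x. f x - f' x))\<^sup>2"
proof (induction m arbitrary: f f')
  case 0
  have "(L2_norm G (convol G (\<psi> 0) (\<lambda>x. f x - f' x)))\<^sup>2 \<le>
      (\<Sum>j\<in>{0..J}. (L2_norm G (convol G (\<psi> j) (\<lambda>x. f x - f' x)))\<^sup>2)"
    by (rule member_le_sum) auto
  also have "\<dots> \<le> (L2_norm G (\<lambda>x. f x - f' x))\<^sup>2" by (rule bessel)
  finally have "(L2_norm G (\<lambda>x. convol G (\<psi> 0) f x - convol G (\<psi> 0) f' x))\<^sup>2
      \<le> (L2_norm G (\<lambda>x. f x - f' x))\<^sup>2"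
    unfolding convol_diff[abs_def] .
  moreover have "{p. set p \<subseteq> {1..J} \<and> length p \<le> 0} = {[]}" by auto
  ultimately show ?case by simp
next
  case (Suc m)
  let ?L = "\<lambda>m. {p. set p \<subseteq> {1..J} \<and> length p \<le> m}"
  let ?U = "\<lambda>j f x. complex_of_real (cmod (convol G (\<psi> j) f x))"
  define D where "D p f f' = (L2_norm G (\<lambda>x. convol G (\<psi> 0) (scatter_prop G \<psi> p f) x
        - convol G (\<psi> 0) (scatter_prop G \<psi> p f') x))\<^sup>2" for p and f f' :: "'a \<Rightarrow> complex"
  have IH: "(\<Sum>p\<in>?L m. D p f f') \<le> (L2_norm G (\<lambda>x. f x - f' x))\<^sup>2" for f f' :: "'a \<Rightarrow> complex"
    unfolding D_def by (rule Suc.IH)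
  have finL: "finite (?L m)" using finite_lists_length_le[of "{1..J}" m] by simp
  have split: "?L (Suc m) = insert [] ((\<lambda>(j, p). j # p) ` ({1..J} \<times> ?L m))"
  proof (rule Set.set_eqI)
    fix p show "p \<in> ?L (Suc m) \<longleftrightarrow> p \<in> insert [] ((\<lambda>(j, p). j # p) ` ({1..J} \<times> ?L m))"
      by (cases p) auto
  qed
  have "(\<Sum>p\<in>?L (Suc m). D p f f') =
      D [] f f' + (\<Sum>p\<in>(\<lambda>(j, p). j # p) ` ({1..J} \<times> ?L m). D p f f')"
    unfolding split using finL by (subst sum.insert) auto
  also have "(\<Sum>p\<in>(\<lambda>(j, p). j # p) ` ({1..J} \<times> ?L m). D p f f') =
      (\<Sum>(j, p)\<in>{1..J} \<times> ?L m. D (j # p) f f')"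
    by (subst sum.reindex) (auto simp: inj_on_def case_prod_unfold intro!: sum.cong)
  also have "\<dots> = (\<Sum>j\<in>{1..J}. \<Sum>p\<in>?L m. D p (?U j f) (?U j f'))"
    by (simp add: sum.cartesian_product D_def)
  also have "\<dots> \<le> (\<Sum>j\<in>{1..J}. (L2_norm G (convol G (\<psi> j) (\<lambda>x. f x - f' x)))\<^sup>2)"
  proof (rule sum_mono)
    fix j
    have "(\<Sum>p\<in>?L m. D p (?U j f) (?U j f')) \<le> (L2_norm G (\<lambda>x. ?U j f x - ?U j f' x))\<^sup>2"
      by (rule IH)
    also have "\<dots> \<le> (L2_norm G (convol G (\<psi> j) (\<lambda>x. f x - f' x)))\<^sup>2"
      unfolding convol_diff[abs_def] of_real_diff[symmetric] norm_of_real
      by (intro L2_norm_square_mono) (simp only: norm_of_real norm_triangle_ineq3)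
    finally show "(\<Sum>p\<in>?L m. D p (?U j f) (?U j f'))
        \<le> (L2_norm G (convol G (\<psi> j) (\<lambda>x. f x - f' x)))\<^sup>2" .
  qed
  also have "D [] f f' = (L2_norm G (convol G (\<psi> 0) (\<lambda>x. f x - f' x)))\<^sup>2"
    unfolding D_def convol_diff[abs_def] by simp
  also have "(L2_norm G (convol G (\<psi> 0) (\<lambda>x. f x - f' x)))\<^sup>2 +
        (\<Sum>j\<in>{1..J}. (L2_norm G (convol G (\<psi> j) (\<lambda>x. f x - f' x)))\<^sup>2) =
      (\<Sum>j\<in>{0..J}. (L2_norm G (convol G (\<psi> j) (\<lambda>x. f x - f' x)))\<^sup>2)"
    by (simp add: sum.atLeast_Suc_atMost)
  also have "\<dots> \<le> (L2_norm G (\<lambda>x. f x - f' x))\<^sup>2" by (rule bessel)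
  finally show ?case unfolding D_def by simp
qed

theorem proposition4p2:
  fixes G :: "('a, 'b) monoid_scheme"
    and k J :: nat
    and d :: "nat \<Rightarrow> nat"
    and \<pi> :: "nat \<Rightarrow> 'a \<Rightarrow> complex mat"
    and \<gamma> :: "nat \<Rightarrow> nat \<Rightarrow> complex"
    and f f' :: "'a \<Rightarrow> complex"
  assumes "group G" and "finite (carrier G)"
    and "complete_irrep_system G k d \<pi>"
    and "J \<ge> 1"
    and "\<forall>r\<in>{1..k}. (\<Sum>j=1..J. (cmod (\<gamma> j r))\<^sup>2) = 1 - (cmod (\<gamma> 0 r))\<^sup>2"
  shows "path_finite G J (\<lambda>p x. scattering G k d \<pi> \<gamma> f p x - scattering G k d \<pi> \<gamma> f' p x) \<and>
         path_norm G J (\<lambda>p x. scattering G k d \<pi> \<gamma> f p x - scattering G k d \<pi> \<gamma> f' p x)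
           \<le> L2_norm G (\<lambda>x. f x - f' x)"
proof -
  interpret group G by fact
  define b where "b = (L2_norm G (\<lambda>x. f x - f' x))\<^sup>2"
  define D where "D p = (L2_norm G (\<lambda>x. scattering G k d \<pi> \<gamma> f p x - scattering G k d \<pi> \<gamma> f' p x))\<^sup>2"
    for p
  have "(\<Sum>j\<in>{0..J}. (cmod (\<gamma> j r))\<^sup>2) \<le> 1" if "r \<in> {1..k}" for r
    using assms(5) that by (simp add: sum.atLeast_Suc_atMost)
  note bessel = wavelet_bessel[OF assms(3,2) this]
  have partial: "sum D F \<le> b" if F: "finite F" "F \<subseteq> paths J" for F
  proof -
    \<comment> \<open>Inserting \<open>0\<close> covers the case of an empty \<open>F\<close>.\<close>
    define m where "m = Max (insert 0 (length ` F))"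
    have "F \<subseteq> {p. set p \<subseteq> {1..J} \<and> length p \<le> m}"
      using F unfolding m_def paths_def by auto
    moreover have "finite {p. set p \<subseteq> {1..J} \<and> length p \<le> m}"
      using finite_lists_length_le[of "{1..J}" m] by simp
    ultimately have "sum D F \<le> sum D {p. set p \<subseteq> {1..J} \<and> length p \<le> m}"
      by (intro sum_mono2) (auto simp: D_def)
    also have "\<dots> \<le> b"
      unfolding D_def b_def scattering_def by (rule scatter_prop_contraction[OF bessel])
    finally show ?thesis .
  qed
  have summable: "D summable_on paths J"
    by (rule nonneg_bdd_above_summable_on)
      (use partial in \<open>auto simp: D_def intro!: bdd_aboveI[of _ b]\<close>)
  have "infsum D (paths J) \<le> b"
    using summable partial by (rule infsum_le_finite_sums)
  hence "sqrt (infsum D (paths J)) \<le> sqrt b" by (rule real_sqrt_le_mono)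
  moreover have "sqrt b = L2_norm G (\<lambda>x. f x - f' x)"
    unfolding b_def by (simp add: L2_norm_nonneg)
  ultimately show ?thesis
    using summable unfolding path_finite_def path_norm_def D_def by simp
qed

end
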